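(* Let $L>0$, let $\Gamma:S_L\to\mathbb{R}^n$ be an arclength parametrized closed curve (not necessarily injective) with image $\gamma=\Gamma(S_L)$, and suppose that $$\sup_{x\in\gamma}\beta_\gamma(x,d)\le\omega(d)\qquad\text{for all } d\in(0,L],$$ where $\omega:[0,L]\to\mathbb{R}$ is a continuous nondecreasing function with $\omega(0)=0$. Then $\gamma$ is a one-dimensional (topological) submanifold of $\mathbb{R}^n$ (possibly with boundary).
   Context: $S_L\cong\mathbb{R}/(L\mathbb{Z})$ is the circle of perimeter $L$. An arclength parametrized closed curve is a Lipschitz map $\Gamma:S_L\to\mathbb{R}^n$ with $|\Gamma'|=1$ a.e. For $x\in\gamma$ and $r>0$, with $B(x,r)$ the closed ball, the Jones $\beta$-number is $$\beta_\gamma(x,r)=\inf\Bigl\{\sup_{y\in\gamma\cap B(x,r)}\frac{\operatorname{dist}(y,G)}{r}\ :\ G\text{ is a straight line through }x\Bigr\}.$$ *)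

theory Defs
  imports "HOL-Analysis.Analysis"
begin

text \<open>
  The circle \<open>S\<^sub>L = \<real>/(L\<int>)\<close> is represented by the real line: a map on \<open>S\<^sub>L\<close> is an
  \<open>L\<close>-periodic function of a real variable, and it is Lipschitz on \<open>S\<^sub>L\<close> with its quotient
  metric iff the periodic function is Lipschitz on the line (with the same constant).
  The image of the closed curve is then \<open>range \<Gamma>\<close>.
\<close>

definition arclength_closed_curve :: "real \<Rightarrow> (real \<Rightarrow> 'a::euclidean_space) \<Rightarrow> bool" where
  "arclength_closed_curve L \<Gamma> \<longleftrightarrow>
     (\<forall>t. \<Gamma> (t + L) = \<Gamma> t) \<and>
     (\<exists>C. C-lipschitz_on UNIV \<Gamma>) \<and>
     (AE t in lebesgue. \<exists>v. (\<Gamma> has_vector_derivative v) (at t) \<and> norm v = 1)"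

definition lines_through :: "'a::euclidean_space \<Rightarrow> 'a set set" where
  "lines_through x = {G. affine G \<and> aff_dim G = 1 \<and> x \<in> G}"

text \<open>
  For \<open>x \<in> \<gamma>\<close> and \<open>r > 0\<close> the real-valued \<open>SUP\<close> and \<open>INF\<close> below are genuine: the supremum
  is over a set containing \<open>x\<close>, the quotients lie in \<open>[0,1]\<close> because
  \<open>infdist y G \<le> dist y x \<le> r\<close>, and there is at least one line through \<open>x\<close>.
\<close>

definition jones_beta :: "'a::euclidean_space set \<Rightarrow> 'a \<Rightarrow> real \<Rightarrow> real" where
  "jones_beta \<gamma> x r =
     (INF G\<in>lines_through x. SUP y\<in>\<gamma> \<inter> cball x r. infdist y G / r)"

text \<open>
  A one-dimensional topological manifold, possibly with boundary, in the subspace topology: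
  locally homeomorphic to open subsets of the half-line. An interior chart onto an open
  interval is covered, since open intervals embed as open subsets of \<open>[0,\<infinity>)\<close>. The Hausdorff
  property and second countability are inherited from the ambient Euclidean space.
\<close>

definition one_dim_submanifold_with_boundary :: "'a::euclidean_space set \<Rightarrow> bool" where
  "one_dim_submanifold_with_boundary M \<longleftrightarrow>
     (\<forall>x\<in>M. \<exists>U V. x \<in> U \<and> openin (top_of_set M) U \<and>
        openin (top_of_set {0::real..}) V \<and> U homeomorphic V)"

end

theory Submission
  imports Defs
begin

text \<open>
  The hypothesis says that \<open>\<gamma>\<close> is thin: near each of its points and at each small scale \<open>r\<close>, it lies
  within \<open>r/100\<close> of a line through that point. The idea is that thinness alone already makes \<open>\<gamma>\<close>
  locally \<^emph>\<open>linearly ordered\<close>, and that a connected set with such an order is an interval.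

  Since \<open>\<gamma>\<close> is connected, it contains points at distance exactly \<open>r\<close> from each of its points. Such a
  point pins down the line at scale \<open>r\<close> up to a small angle, so the line at \<open>x\<close> at scale \<open>r/2\<close>
  and the line at a point nearby at scale \<open>r\<close> are almost parallel. The lines may keep turning as
  the scale decreases (the total turning is not bounded; spirals occur), but an
  orientation chosen once at the largest scale propagates from each scale to the next, and the
  choices made at two nearby points agree (\<open>coherent_directions\<close>). Now say that \<open>x\<close> precedes \<open>y\<close> if
  \<open>y - x\<close> points in the positive direction chosen at \<open>x\<close> at the scale \<open>\<bar>x - y\<bar>\<close>. As the
  directions at \<open>x\<close> and \<open>y\<close> agree, exactly one of two distinct points precedes the other, and
  as \<open>y - x\<close> is almost parallel to the direction, the relation is locally constant off the
  diagonal (\<open>coherent_directions_imp_order\<close>).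

  On a connected set, such a relation is automatically a linear order with connected intervals
  (locale \<open>connected_separation_order\<close>). The measure of the set of parameters \<open>t\<close> such that
  \<open>\<Gamma> t\<close> precedes \<open>y\<close> is then a real coordinate for \<open>y\<close>: it is continuous because the fibres
  of \<open>\<Gamma>\<close> are null sets, and strictly increasing because a null set of parameters cannot have a
  nondegenerate connected image (\<open>separation_order_imp_real_embedding\<close>). A path image is locally
  connected, so each point of \<open>\<gamma>\<close> has a compact connected neighbourhood to which
  this applies. The coordinate maps it homeomorphically onto a compact interval.
\<close>

section \<open>Approximating lines\<close>

lemma norm_minus_projection_le:
  fixes u v :: "'a::real_inner"
  assumes "norm u = 1"
  shows "norm (v - (v \<bullet> u) *\<^sub>R u) \<le> norm (v - c *\<^sub>R u)"
proof -
  have uu: "u \<bullet> u = 1" using assms by (simp add: norm_eq_1)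
  have "(norm (v - c *\<^sub>R u))\<^sup>2 - (norm (v - (v \<bullet> u) *\<^sub>R u))\<^sup>2 = (c - v \<bullet> u)\<^sup>2"
    unfolding power2_norm_eq_inner
    by (simp add: inner_diff_left inner_diff_right uu inner_commute power2_eq_square algebra_simps)
  then have "(norm (v - (v \<bullet> u) *\<^sub>R u))\<^sup>2 \<le> (norm (v - c *\<^sub>R u))\<^sup>2"
    by (smt (verit) zero_le_power2)
  then show ?thesis
    by (rule power2_le_imp_le) simp
qed

lemma lines_through_direction:
  fixes x :: "'a::euclidean_space"
  assumes "G \<in> lines_through x"
  obtains u where "norm u = 1" "\<And>a. a \<in> G \<Longrightarrow> \<exists>c. a - x = c *\<^sub>R u"
proof -
  have G: "x \<in> G" "collinear G"
    using assms by (auto simp: lines_through_def collinear_aff_dim)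
  then obtain w where w: "\<And>a. a \<in> G \<Longrightarrow> \<exists>c. a - x = c *\<^sub>R w"
    unfolding collinear_def by blast
  obtain b :: 'a where "b \<in> Basis" using nonempty_Basis by blast
  define u where "u = (if w = 0 then b else w /\<^sub>R norm w)"
  have "norm u = 1" using \<open>b \<in> Basis\<close> by (auto simp: u_def)
  moreover have "\<exists>c. a - x = c *\<^sub>R u" if a: "a \<in> G" for a
  proof -
    obtain c where c: "a - x = c *\<^sub>R w" using w[OF a] by blast
    then have "a - x = (if w = 0 then 0 else c * norm w) *\<^sub>R u" by (auto simp: u_def)
    then show ?thesis by blast
  qed
  ultimately show thesis using that by blast
qed

text \<open>
  On the reals, \<open>SUP\<close> and \<open>INF\<close> say something only for bounded nonempty families. All quotients lie
  in \<open>[0,1]\<close>, because every line passes through \<open>x\<close>, and \<open>x\<close> itself contributes the quotient \<open>0\<close>.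
\<close>
lemma jones_beta_well_defined:
  fixes \<gamma> :: "'a::euclidean_space set"
  assumes "x \<in> \<gamma>" "r > 0"
  shows "lines_through x \<noteq> {}"
    and "\<And>G. G \<in> lines_through x \<Longrightarrow> bdd_above ((\<lambda>y. infdist y G / r) ` (\<gamma> \<inter> cball x r))"
    and "\<And>G. G \<in> lines_through x \<Longrightarrow> (SUP y\<in>\<gamma> \<inter> cball x r. infdist y G / r) \<le> 1"
    and "bdd_below ((\<lambda>G. SUP y\<in>\<gamma> \<inter> cball x r. infdist y G / r) ` lines_through x)"
proof -
  have le1: "infdist y G / r \<le> 1" if "G \<in> lines_through x" "y \<in> \<gamma> \<inter> cball x r" for y G
    using that infdist_le[of x G y] \<open>r > 0\<close> by (auto simp: lines_through_def dist_commute)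
  show bdd: "bdd_above ((\<lambda>y. infdist y G / r) ` (\<gamma> \<inter> cball x r))" if "G \<in> lines_through x" for G
    using le1[OF that] by (rule bdd_aboveI2)
  have x: "x \<in> \<gamma> \<inter> cball x r" using assms by auto
  obtain b :: 'a where b: "b \<in> Basis" using nonempty_Basis by blast
  have "affine hull {x, x + b} \<in> lines_through x"
    using b by (auto simp: lines_through_def hull_inc aff_dim_2)
  then show "lines_through x \<noteq> {}" by blast
  show "(SUP y\<in>\<gamma> \<inter> cball x r. infdist y G / r) \<le> 1" if "G \<in> lines_through x" for G
    using x le1[OF that] by (intro cSUP_least) auto
  show "bdd_below ((\<lambda>G. SUP y\<in>\<gamma> \<inter> cball x r. infdist y G / r) ` lines_through x)"
  proof (rule bdd_belowI2)
    fix G assume G: "G \<in> lines_through x"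
    have "0 \<le> infdist x G / r" using \<open>r > 0\<close> by (simp add: infdist_nonneg)
    also have "\<dots> \<le> (SUP y\<in>\<gamma> \<inter> cball x r. infdist y G / r)"
      by (rule cSUP_upper[OF x bdd[OF G]])
    finally show "0 \<le> (SUP y\<in>\<gamma> \<inter> cball x r. infdist y G / r)" .
  qed
qed

lemma jones_beta_le_1:
  fixes \<gamma> :: "'a::euclidean_space set"
  assumes "x \<in> \<gamma>" "r > 0"
  shows "jones_beta \<gamma> x r \<le> 1"
proof -
  obtain G where G: "G \<in> lines_through x" using jones_beta_well_defined(1)[OF assms] by blast
  show ?thesis unfolding jones_beta_def
    by (rule cINF_lower2[OF jones_beta_well_defined(4)[OF assms] G jones_beta_well_defined(3)[OF assms G]])
qed

lemma jones_beta_less_imp_direction: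
  fixes \<gamma> :: "'a::euclidean_space set"
  assumes "x \<in> \<gamma>" "r > 0" "jones_beta \<gamma> x r < \<epsilon>"
  obtains u where "norm u = 1"
    "\<And>y. y \<in> \<gamma> \<Longrightarrow> dist x y \<le> r \<Longrightarrow> norm (y - x - ((y - x) \<bullet> u) *\<^sub>R u) \<le> \<epsilon> * r"
proof -
  note wd = jones_beta_well_defined[OF assms(1,2)]
  obtain G where G: "G \<in> lines_through x"
    and less: "(SUP y\<in>\<gamma> \<inter> cball x r. infdist y G / r) < \<epsilon>"
    using assms(3) unfolding jones_beta_def cINF_less_iff[OF wd(1,4)] by blast
  obtain u where u: "norm u = 1" "\<And>a. a \<in> G \<Longrightarrow> \<exists>c. a - x = c *\<^sub>R u"
    using lines_through_direction[OF G] by blast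
  show thesis
  proof (rule that[OF u(1)])
    fix y assume y: "y \<in> \<gamma>" "dist x y \<le> r"
    have "infdist y G / r \<le> (SUP y\<in>\<gamma> \<inter> cball x r. infdist y G / r)"
      using y by (intro cSUP_upper wd(2)[OF G]) auto
    then have "infdist y G < \<epsilon> * r" using less \<open>r > 0\<close>
      by (metis dual_order.strict_trans2 pos_divide_less_eq)
    moreover have "G \<noteq> {}" using G by (auto simp: lines_through_def)
    ultimately obtain a where a: "a \<in> G" "dist y a < \<epsilon> * r"
      by (subst (asm) infdist_notempty, simp, subst (asm) cINF_less_iff) auto
    obtain c where c: "a - x = c *\<^sub>R u" using u(2) a(1) by blast
    have "norm (y - x - ((y - x) \<bullet> u) *\<^sub>R u) \<le> norm (y - x - c *\<^sub>R u)"
      by (rule norm_minus_projection_le[OF u(1)])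
    also have "\<dots> = dist y a" by (simp add: dist_norm flip: c)
    finally show "norm (y - x - ((y - x) \<bullet> u) *\<^sub>R u) \<le> \<epsilon> * r" using a by linarith
  qed
qed

text \<open>
  Both unit vectors are compared with \<open>v / norm v\<close>: if \<open>v\<close> is nearly \<open>a *\<^sub>R u\<close>, then \<open>\<bar>a\<bar>\<close> is nearly
  \<open>norm v\<close>, so that replacing \<open>a\<close> by \<open>\<plusminus> norm v\<close> at most doubles the error.
\<close>
lemma unit_vectors_close_up_to_sign:
  fixes u w v :: "'a::real_inner"
  assumes "norm u = 1" "norm w = 1" "norm v = d" "d > 0"
    and "norm (v - a *\<^sub>R u) \<le> \<eta> * d" "norm (v - b *\<^sub>R w) \<le> \<theta> * d"
  shows "norm (w - u) \<le> 2 * (\<eta> + \<theta>) \<or> norm (w + u) \<le> 2 * (\<eta> + \<theta>)"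
proof -
  have *: "\<exists>s\<in>{1,-1}. norm (v - (s * d) *\<^sub>R z) \<le> 2 * \<kappa> * d"
    if "norm z = 1" "norm (v - c *\<^sub>R z) \<le> \<kappa> * d" for z c \<kappa>
  proof -
    define s where "s = (if c \<ge> 0 then 1 else - 1 :: real)"
    have "\<bar>norm v - norm (c *\<^sub>R z)\<bar> \<le> \<kappa> * d"
      using norm_triangle_ineq3[of v "c *\<^sub>R z"] that by linarith
    then have "\<bar>d - \<bar>c\<bar>\<bar> \<le> \<kappa> * d" using that assms by simp
    then have "\<bar>c - s * d\<bar> \<le> \<kappa> * d" by (auto simp: s_def split: if_splits)
    then have 2: "norm ((c - s * d) *\<^sub>R z) \<le> \<kappa> * d" using that by simp
    have "v - (s * d) *\<^sub>R z = (v - c *\<^sub>R z) + (c - s * d) *\<^sub>R z"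
      by (simp add: algebra_simps)
    then have "norm (v - (s * d) *\<^sub>R z) \<le> \<kappa> * d + \<kappa> * d"
      using that 2 by (metis add_mono norm_triangle_le)
    then show ?thesis by (auto simp: s_def split: if_splits)
  qed
  obtain s where s: "s \<in> {1,-1}" "norm (v - (s * d) *\<^sub>R u) \<le> 2 * \<eta> * d"
    using *[OF assms(1,5)] by blast
  obtain t where t: "t \<in> {1,-1}" "norm (v - (t * d) *\<^sub>R w) \<le> 2 * \<theta> * d"
    using *[OF assms(2,6)] by blast
  have "d * norm (t *\<^sub>R w - s *\<^sub>R u) = norm (d *\<^sub>R (t *\<^sub>R w - s *\<^sub>R u))"
    using assms(4) by simp
  also have "\<dots> = norm ((v - (s * d) *\<^sub>R u) - (v - (t * d) *\<^sub>R w))"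
    by (simp add: algebra_simps)
  also have "\<dots> \<le> 2 * \<eta> * d + 2 * \<theta> * d"
    using s t by (meson add_mono norm_triangle_ineq4 order_trans)
  finally have "d * norm (t *\<^sub>R w - s *\<^sub>R u) \<le> d * (2 * (\<eta> + \<theta>))"
    using assms(4) by (simp add: algebra_simps)
  then have "norm (t *\<^sub>R w - s *\<^sub>R u) \<le> 2 * (\<eta> + \<theta>)"
    using assms(4) mult_le_cancel_left_pos by blast
  moreover have "norm (- w + u) = norm (w - u)" "norm (- w - u) = norm (w + u)"
    by (metis minus_diff_eq norm_minus_cancel uminus_add_conv_diff)
       (metis minus_add_distrib norm_minus_cancel uminus_add_conv_diff add.commute)
  ultimately show ?thesis using s(1) t(1) by auto
qed

section \<open>Coherent orientation of the lines\<close>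

text \<open>
  An unoriented direction \<open>u k x\<close> is available at each point \<open>x\<close> and each scale \<open>R / 2^k\<close>. The
  orientation at the largest scale is one vector for all points, and at scale \<open>k + 1\<close> the sign is
  the one that makes an acute angle with the vector already chosen at scale \<open>k\<close>. Two such
  vectors at nearby points and adjacent scales differ by at most \<open>1/10\<close> up to sign. If they agree
  to within \<open>1/5\<close> at one scale, then an opposite sign at the next would force two vectors forming an
  acute angle to have a sum of norm at most \<open>3/10\<close>. So the errors do not accumulate,
  although the directions may turn without bound.
\<close>
lemma coherent_directions:
  fixes \<gamma> :: "'a::euclidean_space set"
  assumes R: "R > 0" and x0: "x0 \<in> \<gamma>"
    and dir: "\<And>x r. x \<in> \<gamma> \<Longrightarrow> 0 < r \<Longrightarrow> r \<le> R \<Longrightarrow> \<exists>u. norm u = 1 \<and>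
       (\<forall>y\<in>\<gamma>. dist x y \<le> r \<longrightarrow> norm (y - x - ((y - x) \<bullet> u) *\<^sub>R u) \<le> 1/100 * r)"
    and sphere: "\<And>x r. x \<in> \<gamma> \<Longrightarrow> 0 < r \<Longrightarrow> r \<le> R \<Longrightarrow> \<exists>z\<in>\<gamma>. dist x z = r"
  obtains e :: "nat \<Rightarrow> 'a \<Rightarrow> 'a" where
    "\<And>k x. x \<in> \<gamma> \<inter> ball x0 (R/4) \<Longrightarrow> norm (e k x) = 1"
    "\<And>k x y. x \<in> \<gamma> \<inter> ball x0 (R/4) \<Longrightarrow> y \<in> \<gamma> \<inter> ball x0 (R/4) \<Longrightarrow> dist x y \<le> R / 2 / 2^k \<Longrightarrow>
       norm (y - x - ((y - x) \<bullet> e k x) *\<^sub>R e k x) \<le> 1/100 * (R / 2 / 2^k)"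
    "\<And>k x. x \<in> \<gamma> \<inter> ball x0 (R/4) \<Longrightarrow> norm (e (Suc k) x - e k x) \<le> 1/10"
    "\<And>k x y. x \<in> \<gamma> \<inter> ball x0 (R/4) \<Longrightarrow> y \<in> \<gamma> \<inter> ball x0 (R/4) \<Longrightarrow> dist x y \<le> R / 2 / 2^k \<Longrightarrow>
       norm (e k x - e k y) \<le> 1/5"
proof -
  define P where "P = (\<lambda>x r u. norm u = 1 \<and>
       (\<forall>y\<in>\<gamma>. dist x y \<le> r \<longrightarrow> norm (y - x - ((y - x) \<bullet> u) *\<^sub>R u) \<le> 1/100 * r))"
  have pw: "R / 2^k \<le> R" for k :: nat
    using R one_le_power[of "2::real" k] by (simp add: divide_le_eq mult_le_cancel_left1 del: one_le_power)
  define u where "u = (\<lambda>k x. SOME u. P x (R / 2^k) u)"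
  have u: "P x (R / 2^k) (u k x)" if "x \<in> \<gamma>" for k x
  proof -
    have "\<exists>u. P x (R / 2^k) u" unfolding P_def using dir[OF that, of "R/2^k"] R pw[of k]
      by simp
    then show ?thesis unfolding u_def by (rule someI_ex)
  qed
  have Pneg: "P x r (- v)" if "P x r v" for x r v using that by (simp add: P_def)
  define E where "E = rec_nat (\<lambda>x. u 0 x0)
     (\<lambda>k f x. if u (Suc k) x \<bullet> f x \<ge> 0 then u (Suc k) x else - u (Suc k) x)"
  have E0: "E 0 x = u 0 x0" for x by (simp add: E_def)
  have ES: "E (Suc k) x = (if u (Suc k) x \<bullet> E k x \<ge> 0 then u (Suc k) x else - u (Suc k) x)" for k x
    by (simp add: E_def)
  have ES_P: "P x (R / 2^Suc k) (E (Suc k) x)" if "x \<in> \<gamma>" for k x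
    using u[OF that, of "Suc k"] Pneg unfolding ES by (simp del: power_Suc)
  have acute: "E (Suc k) x \<bullet> E k x \<ge> 0" for k x unfolding ES by auto
  have Eunit: "norm (E k x) = 1" if "x \<in> \<gamma>" for k x
    using ES_P[OF that] u[OF x0, of 0] by (cases k) (auto simp: P_def E0)
  let ?K = "\<gamma> \<inter> ball x0 (R/4)"

  \<comment> \<open>The point \<open>z\<close> at distance \<open>d\<close> from \<open>y\<close> ties the lines at both scales to the vector \<open>z - y\<close>.
    At scale \<open>0\<close> the direction belongs to \<open>x0\<close> rather than to \<open>x\<close>, hence the base point \<open>p\<close>.\<close>
  have unsigned: "norm (E (Suc k) y - E k x) \<le> 1/10 \<or> norm (E (Suc k) y + E k x) \<le> 1/10"
    if xy: "x \<in> ?K" "y \<in> ?K" "dist x y \<le> R / 2^Suc k" for k x y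
  proof -
    define d where "d = R / 2^Suc k"
    have d: "0 < d" "d \<le> R" "2 * d = R / 2^k"
      using R pw[of "Suc k"] by (auto simp: d_def)
    obtain z where z: "z \<in> \<gamma>" "dist y z = d" using sphere[of y d] xy d by auto
    obtain p where p: "P p (2 * d) (E k x)" "dist p y \<le> 2 * d" "dist p z \<le> 2 * d"
    proof (cases k)
      case 0
      have 1: "d = R / 2" using 0 by (simp add: d_def)
      have 2: "dist x0 y < R/4" using xy by auto
      then have "dist x0 z \<le> R/4 + R/2" using z 1 dist_triangle[of x0 z y] by linarith
      then show thesis using that[of x0] u[OF x0, of 0] 1 2 R by (auto simp: 0 E0)
    next
      case (Suc j)
      have "dist x y \<le> d" using xy by (simp add: d_def)
      moreover from this have "dist x z \<le> 2 * d" using z dist_triangle[of x z y] by linarith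
      moreover have "P x (2 * d) (E k x)" using ES_P[of x j] xy d(3) Suc by auto
      ultimately show thesis using that[of x] d by auto
    qed
    let ?w = "E k x"
    have tube: "norm (q - p - ((q - p) \<bullet> ?w) *\<^sub>R ?w) \<le> 1/100 * (2 * d)"
      if "q \<in> \<gamma>" "dist p q \<le> 2 * d" for q
      using p(1) that unfolding P_def by blast
    have "norm ((z - p - ((z - p) \<bullet> ?w) *\<^sub>R ?w) - (y - p - ((y - p) \<bullet> ?w) *\<^sub>R ?w))
        \<le> 1/100 * (2 * d) + 1/100 * (2 * d)"
      using xy(2) by (intro norm_triangle_le_diff add_mono[OF tube[OF z(1) p(3)] tube[OF _ p(2)]]) auto
    moreover have "(z - p - ((z - p) \<bullet> ?w) *\<^sub>R ?w) - (y - p - ((y - p) \<bullet> ?w) *\<^sub>R ?w)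
        = z - y - ((z - y) \<bullet> ?w) *\<^sub>R ?w"
      by (simp add: algebra_simps inner_diff_left)
    ultimately have "norm (z - y - ((z - y) \<bullet> ?w) *\<^sub>R ?w) \<le> 4/100 * d" by simp
    moreover have "norm (z - y - ((z - y) \<bullet> E (Suc k) y) *\<^sub>R E (Suc k) y) \<le> 1/100 * d"
      using ES_P[of y k] xy z by (auto simp: P_def d_def)
    moreover have "norm (z - y) = d" using z by (simp add: dist_norm norm_minus_commute)
    ultimately have "norm (E (Suc k) y - E k x) \<le> 2 * (4/100 + 1/100) \<or>
        norm (E (Suc k) y + E k x) \<le> 2 * (4/100 + 1/100)"
      using xy d by (intro unit_vectors_close_up_to_sign[of "E k x" "E (Suc k) y" "z - y" d] Eunit) auto
    then show ?thesis by simp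
  qed
  have sum_large: "norm (a + b) > 1" if "a \<bullet> b \<ge> 0" "norm a = 1" "norm b = 1" for a b :: 'a
  proof -
    have "(norm (a + b))\<^sup>2 = (norm a)\<^sup>2 + (norm b)\<^sup>2 + 2 * (a \<bullet> b)"
      unfolding power2_norm_eq_inner by (simp add: inner_add_left inner_add_right inner_commute)
    then have "1\<^sup>2 < (norm (a + b))\<^sup>2" using that by simp
    then show ?thesis by (rule power_less_imp_less_base) simp
  qed
  have scale: "norm (E (Suc k) x - E k x) \<le> 1/10" if "x \<in> ?K" for k x
  proof -
    have "dist x x \<le> R / 2^Suc k" using R by simp
    moreover have "norm (E (Suc k) x + E k x) > 1"
      using sum_large[OF acute[of k x]] Eunit that by blast
    ultimately show ?thesis using unsigned[of x x k] that by linarith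
  qed
  have point: "norm (E k x - E k y) \<le> 1/5"
    if "x \<in> ?K" "y \<in> ?K" "dist x y \<le> R / 2^k" for k x y
    using that
  proof (induction k)
    case 0
    then show ?case by (simp add: E0)
  next
    case (Suc k)
    have "R / 2^Suc k \<le> R / 2^k" using R by (simp add: field_simps)
    then have IH: "norm (E k x - E k y) \<le> 1/5" using Suc by (simp del: power_Suc)
    have "norm (E (Suc k) y - E k x) \<le> 1/10"
    proof (rule ccontr)
      assume "\<not> ?thesis"
      then have "norm (E (Suc k) y + E k x) \<le> 1/10" using unsigned Suc by blast
      moreover have "norm (E (Suc k) y + E k y) > 1"
        using sum_large[OF acute[of k y]] Eunit Suc by auto
      moreover have "norm (E (Suc k) y + E k y) \<le> norm (E (Suc k) y + E k x) + norm (E k x - E k y)"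
        using norm_triangle_ineq4[of "E (Suc k) y + E k x" "E k x - E k y"] by (simp add: algebra_simps)
      ultimately show False using IH by linarith
    qed
    moreover have "norm (E (Suc k) x - E (Suc k) y)
        \<le> norm (E (Suc k) x - E k x) + norm (E (Suc k) y - E k x)"
      by (metis dist_norm dist_triangle2)
    ultimately show ?case using scale[OF Suc.prems(1), of k] by linarith
  qed
  show thesis
    \<comment> \<open>\<open>E 0\<close> is the direction of a line through \<open>x0\<close> only, so the numbering starts at \<open>E 1\<close>.\<close>
  proof (rule that[of "\<lambda>k. E (Suc k)"])
    show "norm (y - x - ((y - x) \<bullet> E (Suc k) x) *\<^sub>R E (Suc k) x) \<le> 1/100 * (R / 2 / 2^k)"
      if "x \<in> ?K" "y \<in> ?K" "dist x y \<le> R / 2 / 2^k" for k x y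
    proof -
      have "R / 2 / 2^k = R / 2^Suc k" by simp
      then show ?thesis using ES_P[of x k] that unfolding P_def by (metis IntD1)
    qed
    show "norm (E (Suc k) x - E (Suc k) y) \<le> 1/5"
      if "x \<in> ?K" "y \<in> ?K" "dist x y \<le> R / 2 / 2^k" for k x y
      using point[of x y "Suc k"] that by simp
  qed (use scale Eunit in auto)
qed

section \<open>Orders on connected sets\<close>

lemma openin_restrict:
  assumes "openin (top_of_set N) S" "C \<subseteq> N"
  shows "openin (top_of_set C) (C \<inter> S)"
  using assms unfolding openin_open by blast

text \<open>
  Transitivity is not assumed: only that each point separates the set into two open sides, and that
  of any two points exactly one is on the upper side of the other. On a connected set, this gives a
  linear order (a form of Eilenberg's criterion for orderability).
\<close>
locale separation_order =
  fixes N :: "'a::metric_space set" and lt :: "'a \<Rightarrow> 'a \<Rightarrow> bool"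
  assumes total: "\<And>x y. x \<in> N \<Longrightarrow> y \<in> N \<Longrightarrow> x \<noteq> y \<Longrightarrow> lt x y \<longleftrightarrow> \<not> lt y x"
    and irrefl: "\<And>x. x \<in> N \<Longrightarrow> \<not> lt x x"
    and open_above: "\<And>x. x \<in> N \<Longrightarrow> openin (top_of_set N) {y \<in> N. lt x y}"
    and open_below: "\<And>x. x \<in> N \<Longrightarrow> openin (top_of_set N) {y \<in> N. lt y x}"
begin

lemma asym: "x \<in> N \<Longrightarrow> y \<in> N \<Longrightarrow> lt x y \<Longrightarrow> \<not> lt y x"
  using total[of x y] irrefl[of x] by (cases "x = y") simp_all

lemma converse: "separation_order N (\<lambda>x y. lt y x)"
  by unfold_locales (use total irrefl open_above open_below in blast)+

lemma subset:
  assumes M: "M \<subseteq> N"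
  shows "separation_order M lt"
proof
  fix x assume "x \<in> M"
  then have x: "x \<in> N" using M by blast
  have eq: "{y \<in> M. lt x y} = M \<inter> {y \<in> N. lt x y}" "{y \<in> M. lt y x} = M \<inter> {y \<in> N. lt y x}"
    using M by blast+
  show "openin (top_of_set M) {y \<in> M. lt x y}"
    unfolding eq by (rule openin_restrict[OF open_above[OF x] M])
  show "openin (top_of_set M) {y \<in> M. lt y x}"
    unfolding eq by (rule openin_restrict[OF open_below[OF x] M])
qed (use total irrefl M in blast)+

end

locale connected_separation_order = separation_order +
  assumes conn: "connected N"
begin

text \<open>
  The points above \<open>x\<close> form a clopen part of the complement of \<open>x\<close>, and in a connected
  set adding \<open>x\<close> to such a part gives a connected set.
\<close>
lemma connected_at_least:
  assumes x: "x \<in> N"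
  shows "connected {y \<in> N. y = x \<or> lt x y}"
proof -
  let ?A = "{y \<in> N. lt x y}"
  have "N - {x} - ?A = {y \<in> N. lt y x}" using total[OF x] irrefl[OF x] by blast
  then have "openin (top_of_set (N - {x})) (N - {x} - ?A)"
    by (metis (no_types, lifting) Diff_subset openin_subset_trans open_below[OF x])
  moreover have sub: "?A \<subseteq> N - {x}" using irrefl x by auto
  ultimately have "closedin (top_of_set (N - {x})) ?A"
    by (simp add: closedin_def)
  moreover have "openin (top_of_set (N - {x})) ?A"
    using sub open_above[OF x] by (metis Diff_subset openin_subset_trans)
  ultimately have "connected ({x} \<union> ?A)"
    using conn x by (intro connected_Un_clopen_in_complement[of "{x}" N]) auto
  moreover have "{y \<in> N. y = x \<or> lt x y} = {x} \<union> ?A" using x by blast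
  ultimately show ?thesis by simp
qed

text \<open>
  Otherwise the two open sides of \<open>x\<close> would disconnect \<open>C\<close>.
\<close>
lemma connected_same_side:
  assumes "connected C" "C \<subseteq> N" "x \<in> N" "x \<notin> C" "y \<in> C" "z \<in> C" "lt x y"
  shows "lt x z"
proof (rule ccontr)
  assume not: "\<not> lt x z"
  have 1: "openin (top_of_set C) (C \<inter> {y \<in> N. lt x y})" "openin (top_of_set C) (C \<inter> {y \<in> N. lt y x})"
    using openin_restrict open_above[OF assms(3)] open_below[OF assms(3)] assms(2) by blast+
  have "C \<subseteq> (C \<inter> {y \<in> N. lt x y}) \<union> (C \<inter> {y \<in> N. lt y x})"
    using total assms by blast
  moreover have "(C \<inter> {y \<in> N. lt x y}) \<inter> (C \<inter> {y \<in> N. lt y x}) = {}"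
    using total[OF assms(3)] irrefl assms(4) by blast
  moreover have "C \<inter> {y \<in> N. lt x y} \<noteq> {}" "C \<inter> {y \<in> N. lt y x} \<noteq> {}"
    using assms not total[of x z] by blast+
  ultimately show False using assms(1) 1 unfolding connected_openin by blast
qed

text \<open>
  The points at or above \<open>y\<close> form a connected set that avoids \<open>x\<close>, so they all lie on the
  side of \<open>x\<close> on which \<open>y\<close> lies.
\<close>
lemma trans:
  assumes "x \<in> N" "y \<in> N" "z \<in> N" "lt x y" "lt y z"
  shows "lt x z"
proof (rule connected_same_side[OF connected_at_least[OF assms(2)] _ assms(1)])
  show "x \<notin> {w \<in> N. w = y \<or> lt y w}" using assms total[of x y] irrefl by auto
qed (use assms in auto)

text \<open>
  An order interval is an initial segment of a final segment, so \<open>connected_at_least\<close> applies twice,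
  the second time to the converse relation on the final segment.
\<close>
lemma connected_between:
  assumes "x \<in> N" "y \<in> N"
  shows "connected {z \<in> N. (z = x \<or> lt x z) \<and> (z = y \<or> lt z y)}"
proof (cases "x = y \<or> lt x y")
  case False
  then have "{z \<in> N. (z = x \<or> lt x z) \<and> (z = y \<or> lt z y)} = {}"
    using trans assms by blast
  then show ?thesis by (metis connected_empty)
next
  case True
  let ?N = "{z \<in> N. z = x \<or> lt x z}"
  interpret below: separation_order ?N lt by (rule subset) auto
  interpret up: connected_separation_order ?N "\<lambda>x y. lt y x"
    by (intro connected_separation_order.intro below.converse
        connected_separation_order_axioms.intro connected_at_least assms(1))
  have "connected {z \<in> ?N. z = y \<or> lt z y}"
    by (rule up.connected_at_least) (use assms True in blast)
  moreover have "{z \<in> ?N. z = y \<or> lt z y} = {z \<in> N. (z = x \<or> lt x z) \<and> (z = y \<or> lt z y)}" by auto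
  ultimately show ?thesis by simp
qed

end

section \<open>From coherent directions to an order\<close>

text \<open>
  The two ends are a factor \<open>4\<close> apart, so that both inequalities can be strict. Strictness makes
  membership of a scale an open condition on the points, and it is paid for by some
  distances belonging to two adjacent scales.
\<close>
lemma dyadic_scale_exists:
  fixes t d :: real
  assumes "0 < t" "t < d"
  obtains k where "d / 2^(k+2) < t" "t < d / 2^k"
proof -
  define P where "P = (\<lambda>n::nat. d / 2^n < t)"
  obtain n where "(1/2)^n < t / d"
    using real_arch_pow_inv[of "t/d" "1/2"] assms by auto
  then have "P n" using assms by (simp add: P_def field_simps power_divide)
  define m where "m = (LEAST n. P n)"
  have m: "P m" unfolding m_def by (rule LeastI[of P, OF \<open>P n\<close>])
  have before: "\<not> P j" if "j < m" for j using not_less_Least that unfolding m_def by blast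
  have "m \<noteq> 0" using m assms by (intro notI) (auto simp: P_def)
  show thesis
  proof (cases "m = 1")
    case True
    then show ?thesis using m assms by (intro that[of 0]) (auto simp: P_def)
  next
    case False
    then obtain k where k: "m = Suc (Suc k)" using \<open>m \<noteq> 0\<close> by (metis One_nat_def not0_implies_Suc)
    have "t \<le> d / 2^Suc k" using before[of "Suc k"] k by (auto simp: P_def)
    also have "\<dots> < d / 2^k" using assms by (simp add: divide_strict_left_mono)
    finally show ?thesis using m k by (intro that[of k]) (auto simp: P_def)
  qed
qed

lemma same_sign:
  fixes a b D :: real
  assumes "\<bar>a\<bar> \<ge> 24/25 * D" "\<bar>b\<bar> \<ge> 24/25 * D" "\<bar>a - b\<bar> \<le> D * (1/5)" "D > 0"
  shows "0 < a \<longleftrightarrow> 0 < b"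
  using assms by linarith

text \<open>
  At a scale comparable with \<open>dist x y\<close>, the vector \<open>y - x\<close> is nearly parallel to \<open>e k x\<close>,
  so its inner product with \<open>e k x\<close> is far from \<open>0\<close>. A change of scale or of base point moves \<open>e k x\<close>
  by a small amount, which cannot change the sign. Hence the sign depends only on the pair of points,
  is reversed when they are exchanged, and is locally constant.
\<close>
lemma coherent_directions_imp_order:
  fixes K :: "'a::real_inner set" and e :: "nat \<Rightarrow> 'a \<Rightarrow> 'a"
  assumes diam: "\<And>x y. x \<in> K \<Longrightarrow> y \<in> K \<Longrightarrow> dist x y < d"
    and unit: "\<And>k x. x \<in> K \<Longrightarrow> norm (e k x) = 1"
    and flat: "\<And>k x y. x \<in> K \<Longrightarrow> y \<in> K \<Longrightarrow> dist x y \<le> d / 2^k \<Longrightarrow>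
       norm (y - x - ((y - x) \<bullet> e k x) *\<^sub>R e k x) \<le> 1/100 * (d / 2^k)"
    and scale: "\<And>k x. x \<in> K \<Longrightarrow> norm (e (Suc k) x - e k x) \<le> 1/10"
    and point: "\<And>k x y. x \<in> K \<Longrightarrow> y \<in> K \<Longrightarrow> dist x y \<le> d / 2^k \<Longrightarrow> norm (e k x - e k y) \<le> 1/5"
  shows "\<exists>lt. separation_order K lt"
proof -
  define apart where "apart = (\<lambda>k (x::'a) y. d / 2^(k+2) < dist x y \<and> dist x y < d / 2^k)"
  define lt where "lt = (\<lambda>x y. \<exists>k. apart k x y \<and> 0 < (y - x) \<bullet> e k x)"
  have apart_commute: "apart k x y = apart k y x" for k x y by (simp add: apart_def dist_commute)
  have apart_ex: "\<exists>k. apart k x y" if "x \<in> K" "y \<in> K" "x \<noteq> y" for x y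
    using dyadic_scale_exists[of "dist x y" d] diam[OF that(1,2)] that(3) unfolding apart_def
    by (metis zero_less_dist_iff)
  have ne: "0 < d" if "x \<in> K" for x using diam[OF that that] by simp
  have large: "\<bar>(y - x) \<bullet> e k x\<bar> \<ge> 24/25 * dist x y" if "x \<in> K" "y \<in> K" "apart k x y" for k x y
  proof -
    let ?c = "(y - x) \<bullet> e k x"
    have "norm (y - x - ?c *\<^sub>R e k x) \<le> 1/100 * (d / 2^k)"
      using flat that by (auto simp: apart_def)
    also have "\<dots> \<le> 1/25 * dist x y" using that by (simp add: apart_def)
    finally have "norm (y - x) - norm (?c *\<^sub>R e k x) \<le> 1/25 * dist x y"
      using norm_triangle_ineq2 order_trans by blast
    then show ?thesis using unit[OF that(1)] by (simp add: dist_norm norm_minus_commute)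
  qed
  have close: "\<bar>v \<bullet> a - v \<bullet> b\<bar> \<le> norm v * c" if "norm (a - b) \<le> c" for v a b :: 'a and c
    by (metis Cauchy_Schwarz_ineq2 inner_diff_right mult_left_mono norm_ge_zero order_trans that)
  have adjacent: "0 < (y - x) \<bullet> e (Suc k) x \<longleftrightarrow> 0 < (y - x) \<bullet> e k x"
    if "x \<in> K" "y \<in> K" "apart k x y" "apart (Suc k) x y" for k x y
  proof (rule same_sign)
    show "\<bar>(y - x) \<bullet> e (Suc k) x - (y - x) \<bullet> e k x\<bar> \<le> dist x y * (1/5)"
      using close[of "e (Suc k) x" "e k x" "1/5" "y - x"] scale[OF that(1), of k]
      by (simp add: dist_norm norm_minus_commute)
    have "0 < d / 2^(k+2)" using ne[OF that(1)] by simp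
    then show "0 < dist x y" using that(3) unfolding apart_def by linarith
  qed (use large that in auto)
  have indep: "0 < (y - x) \<bullet> e k x \<longleftrightarrow> 0 < (y - x) \<bullet> e l x"
    if "x \<in> K" "y \<in> K" "apart k x y" "apart l x y" for k l x y
  proof -
    have less: "l < Suc (Suc k)" if "apart k x y" "apart l x y" for k l
    proof (rule ccontr)
      assume "\<not> l < Suc (Suc k)"
      then have "(2::real)^(k+2) \<le> 2^l" by (intro power_increasing) auto
      then have "d / 2^l \<le> d / 2^(k+2)" using less_imp_le[OF ne[OF \<open>x \<in> K\<close>]] by (intro divide_left_mono) auto
      then show False using that by (simp add: apart_def)
    qed
    have "l = k \<or> l = Suc k \<or> k = Suc l" using less[of k l] less[of l k] that by linarith
    then show ?thesis using adjacent that by blast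
  qed
  have lt_iff: "lt x y \<longleftrightarrow> 0 < (y - x) \<bullet> e k x" if "x \<in> K" "y \<in> K" "apart k x y" for x y k
    using indep[OF that(1,2)] that(3) unfolding lt_def by blast
  have anti: "lt x y \<longleftrightarrow> \<not> lt y x" if xy: "x \<in> K" "y \<in> K" "x \<noteq> y" for x y
  proof -
    obtain k where k: "apart k x y" using apart_ex xy by blast
    have flip: "(x - y) \<bullet> e k y = - ((y - x) \<bullet> e k y)" by (simp add: inner_diff_left)
    have pos: "0 < dist x y" using xy by simp
    have large': "\<bar>(y - x) \<bullet> e k y\<bar> \<ge> 24/25 * dist x y"
      using large[OF xy(2,1), of k] k apart_commute[of k x y] flip by (simp add: dist_commute)
    have "0 < (y - x) \<bullet> e k x \<longleftrightarrow> 0 < (y - x) \<bullet> e k y"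
    proof (rule same_sign[OF large[OF xy(1,2) k] large' _ pos])
      show "\<bar>(y - x) \<bullet> e k x - (y - x) \<bullet> e k y\<bar> \<le> dist x y * (1/5)"
        using close[OF point[of x y k], of "y - x"] k xy
        by (simp add: apart_def dist_norm norm_minus_commute)
    qed
    then have "0 < (y - x) \<bullet> e k x \<longleftrightarrow> \<not> 0 < (x - y) \<bullet> e k y"
      using large' pos unfolding flip by linarith
    then show ?thesis using lt_iff xy k apart_commute by metis
  qed
  have irrefl: "\<not> lt x x" if "x \<in> K" for x using ne[OF that] by (simp add: lt_def)
  have op: "openin (top_of_set K) {y \<in> K. \<exists>k. apart k x y \<and> 0 < s * ((y - x) \<bullet> e k x)}" for x s
  proof -
    have "open (\<Union>k. {y. d / 2^(k+2) < dist x y} \<inter> {y. dist x y < d / 2^k}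
       \<inter> {y. 0 < s * ((y - x) \<bullet> e k x)})"
      by (intro open_UN ballI open_Int open_Collect_less continuous_intros)
    moreover have "{y \<in> K. \<exists>k. apart k x y \<and> 0 < s * ((y - x) \<bullet> e k x)} = K \<inter>
       (\<Union>k. {y. d / 2^(k+2) < dist x y} \<inter> {y. dist x y < d / 2^k}
       \<inter> {y. 0 < s * ((y - x) \<bullet> e k x)})" by (auto simp: apart_def)
    ultimately show ?thesis by (simp add: openin_open_Int)
  qed
  \<comment> \<open>The set of points below \<open>x\<close> is expressed by the directions at \<open>x\<close>, as \<open>lt y x\<close> itself
    refers to the directions at the varying point \<open>y\<close>.\<close>
  have below: "lt y x \<longleftrightarrow> (\<exists>k. apart k x y \<and> 0 < - 1 * ((y - x) \<bullet> e k x))" if "x \<in> K" "y \<in> K" for x y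
  proof (cases "x = y")
    case True
    then show ?thesis using irrefl that ne by (auto simp: apart_def)
  next
    case False
    have "0 < - 1 * ((y - x) \<bullet> e k x) \<longleftrightarrow> \<not> 0 < (y - x) \<bullet> e k x" if "apart k x y" for k
    proof -
      have "0 < dist x y" using False by simp
      then show ?thesis using large[OF \<open>x \<in> K\<close> \<open>y \<in> K\<close> that] by linarith
    qed
    then show ?thesis using anti[OF that False] lt_iff[OF that] apart_ex[OF that False] by blast
  qed
  have "separation_order K lt"
  proof
    show "openin (top_of_set K) {y \<in> K. lt x y}" for x
      using op[of x 1] by (simp add: lt_def)
    show "openin (top_of_set K) {y \<in> K. lt y x}" if "x \<in> K" for x
    proof -
      have "{y \<in> K. lt y x} = {y \<in> K. \<exists>k. apart k x y \<and> 0 < - 1 * ((y - x) \<bullet> e k x)}"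
        using below[OF that] by blast
      then show ?thesis using op[of x "- 1"] by metis
    qed
  qed (use anti irrefl in blast)+
  then show ?thesis by blast
qed

section \<open>A real coordinate from the parametrization\<close>

lemma arclength_closed_curve_Lipschitz:
  assumes "arclength_closed_curve L \<Gamma>"
  obtains B where "\<And>s t. norm (\<Gamma> s - \<Gamma> t) \<le> B * norm (s - t)"
  using assms unfolding arclength_closed_curve_def lipschitz_on_def dist_norm by blast

lemma arclength_closed_curve_continuous:
  assumes "arclength_closed_curve L \<Gamma>"
  shows "continuous_on S \<Gamma>"
proof -
  obtain C where "C-lipschitz_on UNIV \<Gamma>"
    using assms unfolding arclength_closed_curve_def by blast
  then show ?thesis by (meson continuous_on_subset lipschitz_on_continuous_on subset_UNIV)
qed

lemma arclength_closed_curve_range: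
  assumes "arclength_closed_curve L \<Gamma>" "L > 0"
  shows "range \<Gamma> = \<Gamma> ` {0..L}"
proof -
  have per: "\<Gamma> (t + L) = \<Gamma> t" for t using assms by (simp add: arclength_closed_curve_def)
  have nat: "\<Gamma> (t + of_nat n * L) = \<Gamma> t" for t n
  proof (induction n)
    case (Suc n)
    have "t + of_nat (Suc n) * L = (t + of_nat n * L) + L" by (simp add: algebra_simps)
    then show ?case using per Suc by metis
  qed simp
  have int: "\<Gamma> (t + of_int k * L) = \<Gamma> t" for t k
  proof (cases "0 \<le> k")
    case True
    then show ?thesis using nat[of t "nat k"] by simp
  next
    case False
    then show ?thesis using nat[of "t + of_int k * L" "nat (- k)"] by simp
  qed
  have "\<Gamma> t \<in> \<Gamma> ` {0..L}" for t
  proof -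
    let ?s = "t + of_int (- \<lfloor>t / L\<rfloor>) * L"
    have "of_int \<lfloor>t / L\<rfloor> \<le> t / L" "t / L \<le> of_int \<lfloor>t / L\<rfloor> + 1" by linarith+
    then have "of_int \<lfloor>t / L\<rfloor> * L \<le> t" "t \<le> (of_int \<lfloor>t / L\<rfloor> + 1) * L"
      using assms(2) by (simp_all only: pos_le_divide_eq pos_divide_le_eq)
    then have "?s \<in> {0..L}" by (auto simp: algebra_simps)
    then show ?thesis using int[of t "- \<lfloor>t / L\<rfloor>"] by (metis image_eqI)
  qed
  then show ?thesis by blast
qed

text \<open>
  Where the derivative exists and is nonzero, \<open>\<Gamma>\<close> is injective at first order, so a parameter of this
  kind is isolated in its fibre. A set all of whose points are isolated is locally negligible, hence negligible.
\<close>
lemma arclength_closed_curve_negligible_fibre: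
  assumes "arclength_closed_curve L \<Gamma>"
  shows "negligible {t. \<Gamma> t = y}"
proof -
  define Bad where "Bad = {t. \<not> (\<exists>v. (\<Gamma> has_vector_derivative v) (at t) \<and> norm v = 1)}"
  have "AE t in lebesgue. t \<notin> Bad"
    using assms by (simp add: arclength_closed_curve_def Bad_def)
  then obtain Z where "Z \<in> null_sets lebesgue" "Bad \<subseteq> Z"
    unfolding eventually_ae_filter by auto
  then have "negligible Bad"
    using negligible_subset[of Z Bad] by (simp only: negligible_iff_null_sets)
  moreover have "negligible ({t. \<Gamma> t = y} - Bad)" (is "negligible ?D")
  proof (subst locally_negligible_alt, intro ballI)
    fix t assume t: "t \<in> ?D"
    then obtain v where v: "(\<Gamma> has_vector_derivative v) (at t)" "norm v = 1"
      by (auto simp: Bad_def)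
    have "\<forall>e>0. \<exists>d>0. \<forall>s. norm (s - t) < d \<longrightarrow>
        norm (\<Gamma> s - \<Gamma> t - (s - t) *\<^sub>R v) \<le> e * norm (s - t)"
      using v(1) unfolding has_vector_derivative_def has_derivative_at_alt by (rule conjunct2)
    from this[rule_format, of "1/2"] obtain d where d: "d > 0"
      "\<And>s. norm (s - t) < d \<Longrightarrow> norm (\<Gamma> s - \<Gamma> t - (s - t) *\<^sub>R v) \<le> 1/2 * norm (s - t)"
      by auto
    have "s = t" if "s \<in> ?D \<inter> ball t d" for s
    proof -
      have "norm (s - t) < d" using that by (simp add: dist_real_def abs_minus_commute)
      moreover have "\<Gamma> s = \<Gamma> t" using that t by auto
      ultimately have "norm ((s - t) *\<^sub>R v) \<le> 1/2 * norm (s - t)" using d(2)[of s] by simp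
      then show ?thesis using v(2) by simp
    qed
    moreover have "t \<in> ?D \<inter> ball t d" using t d(1) centre_in_ball by blast
    ultimately have "?D \<inter> ball t d = {t}" by blast
    then have "openin (top_of_set ?D) {t}" by (metis open_ball openin_open_Int)
    then show "\<exists>U. openin (top_of_set ?D) U \<and> t \<in> U \<and> negligible U" by auto
  qed
  ultimately have "negligible (Bad \<union> ?D)" by (rule negligible_Un)
  then show ?thesis by (rule negligible_subset) auto
qed

text \<open>
  The distance from \<open>x\<close> maps \<open>C\<close> onto a set containing a nondegenerate interval, whereas its
  composition with \<open>\<Gamma>\<close>, a Lipschitz function of one real variable, maps null sets to null sets.
\<close>
lemma Lipschitz_preimage_not_negligible:
  fixes \<Gamma> :: "real \<Rightarrow> 'a::euclidean_space"
  assumes Lip: "\<And>s t. norm (\<Gamma> s - \<Gamma> t) \<le> B * norm (s - t)"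
    and C: "connected C" "C \<subseteq> \<Gamma> ` T" "x \<in> C" "y \<in> C" "x \<noteq> y"
  shows "\<not> negligible {t \<in> T. \<Gamma> t \<in> C}"
proof
  assume neg: "negligible {t \<in> T. \<Gamma> t \<in> C}"
  let ?p = "\<lambda>t. dist x (\<Gamma> t)"
  have Lp: "norm (?p s - ?p t) \<le> B * norm (s - t)" for s t
  proof -
    have "norm (?p s - ?p t) \<le> dist (\<Gamma> s) (\<Gamma> t)"
      by (metis abs_dist_diff_le dist_commute real_norm_def)
    then show ?thesis using Lip[of s t] by (simp add: dist_norm)
  qed
  have "negligible (?p ` {t \<in> T. \<Gamma> t \<in> C})"
    by (rule negligible_locally_Lipschitz_image[OF _ neg]) (use Lp in \<open>auto intro!: exI[of _ UNIV]\<close>)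
  moreover have "{0..dist x y} \<subseteq> ?p ` {t \<in> T. \<Gamma> t \<in> C}"
  proof -
    have "connected (dist x ` C)" by (intro connected_continuous_image C continuous_intros)
    moreover have "0 \<in> dist x ` C" "dist x y \<in> dist x ` C" using C by force+
    ultimately have "{0..dist x y} \<subseteq> dist x ` C" by (rule connected_contains_Icc)
    also have "\<dots> \<subseteq> ?p ` {t \<in> T. \<Gamma> t \<in> C}" using C(2) by blast
    finally show ?thesis .
  qed
  ultimately have "negligible (cbox 0 (dist x y))" by (simp add: negligible_subset)
  then have "box 0 (dist x y) = {}" unfolding negligible_interval .
  then show False using C(5) by simp
qed

lemma eventually_in_openin:
  assumes "openin (top_of_set N) S" "a \<in> S" "\<And>n. x n \<in> N" "x \<longlonglongrightarrow> a"
  shows "\<forall>\<^sub>F n in sequentially. x n \<in> S"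
proof -
  obtain T where T: "open T" "S = N \<inter> T" using assms(1) by (auto simp: openin_open)
  then have "\<forall>\<^sub>F n in sequentially. x n \<in> T" using assms by (intro topological_tendstoD) auto
  then show ?thesis using T assms(3) by simp
qed

text \<open>
  The coordinate of \<open>y\<close> is the measure of the set \<open>A y\<close> of parameters whose image precedes \<open>y\<close>. For \<open>x\<close>
  before \<open>y\<close>, the set \<open>A y - A x\<close> contains, up to the null fibre of \<open>y\<close>, all parameters of the
  connected interval between \<open>x\<close> and \<open>y\<close>, so the measure increases strictly. If \<open>x n\<close> tends to
  \<open>a\<close>, then whether \<open>\<Gamma> t\<close> precedes \<open>x n\<close> is eventually constant for each \<open>t\<close> outside the
  null fibre of \<open>a\<close>, so dominated convergence gives continuity.
\<close>
lemma separation_order_imp_real_embedding: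
  fixes \<Gamma> :: "real \<Rightarrow> 'a::euclidean_space"
  assumes \<Gamma>: "arclength_closed_curve L \<Gamma>" "L > 0"
    and N: "closed N" "N \<subseteq> range \<Gamma>"
    and ord: "connected_separation_order N lt"
  obtains f :: "'a \<Rightarrow> real" where "continuous_on N f" "inj_on f N"
proof -
  interpret connected_separation_order N lt by (rule ord)
  note cont = arclength_closed_curve_continuous[OF \<Gamma>(1)]
  note fibre = arclength_closed_curve_negligible_fibre[OF \<Gamma>(1)]
  define A where "A = (\<lambda>y. {t \<in> {0..L}. \<Gamma> t \<in> {w \<in> N. lt w y}})"
  define f where "f = (\<lambda>y. measure lebesgue (A y))"
  have meas: "A y \<in> lmeasurable" if y: "y \<in> N" for y
  proof (rule bounded_set_imp_lmeasurable)
    show "bounded (A y)" by (rule bounded_subset[of "{0..L}"]) (auto simp: A_def)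
    obtain T where T: "open T" "{w \<in> N. lt w y} = N \<inter> T"
      using open_below[OF y] unfolding openin_open by blast
    have "A y = {0..L} \<inter> \<Gamma> -` N \<inter> \<Gamma> -` T" unfolding A_def T(2) by auto
    moreover have "closed (\<Gamma> -` N)" "open (\<Gamma> -` T)"
      using cont[of UNIV] N(1) T(1) by (auto intro: closed_vimage open_vimage)
    ultimately have "A y \<in> sets borel" by simp
    then show "A y \<in> sets lebesgue" by simp
  qed
  have mono: "f x < f y" if xy: "x \<in> N" "y \<in> N" "lt x y" for x y
  proof -
    have sub: "A x \<subseteq> A y" using trans[OF _ xy(1,2) _ xy(3)] unfolding A_def by blast
    have "x \<noteq> y" using xy irrefl by blast
    define C where "C = {z \<in> N. (z = x \<or> lt x z) \<and> (z = y \<or> lt z y)}"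
    have "C \<subseteq> \<Gamma> ` {0..L}"
      using N(2) arclength_closed_curve_range[OF \<Gamma>] by (auto simp: C_def)
    moreover have "connected C" unfolding C_def by (rule connected_between[OF xy(1,2)])
    moreover have "x \<in> C" "y \<in> C" using xy by (auto simp: C_def)
    moreover obtain B where "\<And>s t. norm (\<Gamma> s - \<Gamma> t) \<le> B * norm (s - t)"
      using arclength_closed_curve_Lipschitz[OF \<Gamma>(1)] by blast
    ultimately have "\<not> negligible {t \<in> {0..L}. \<Gamma> t \<in> C}"
      using \<open>x \<noteq> y\<close> by (intro Lipschitz_preimage_not_negligible[of \<Gamma> B C "{0..L}" x y])
    moreover have "{t \<in> {0..L}. \<Gamma> t \<in> C} \<subseteq> (A y - A x) \<union> {t. \<Gamma> t = y}"
    proof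
      fix t assume t: "t \<in> {t \<in> {0..L}. \<Gamma> t \<in> C}"
      have "\<Gamma> t \<in> N" "\<Gamma> t = x \<or> lt x (\<Gamma> t)" using t unfolding C_def by blast+
      then have "\<not> lt (\<Gamma> t) x" using irrefl total[of x "\<Gamma> t"] xy(1) by blast
      then show "t \<in> (A y - A x) \<union> {t. \<Gamma> t = y}" using t by (auto simp: A_def C_def)
    qed
    ultimately have "\<not> negligible ((A y - A x) \<union> {t. \<Gamma> t = y})"
      by (blast intro: negligible_subset)
    then have "\<not> negligible (A y - A x)" using fibre by simp
    moreover have "A y - A x \<in> lmeasurable" using meas xy by (intro fmeasurable_Diff) auto
    ultimately have "measure lebesgue (A y - A x) \<noteq> 0" by (simp add: negligible_iff_measure0)
    moreover have "measure lebesgue (A y - A x) = f y - f x"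
      unfolding f_def using measurable_measure_Diff meas sub xy by blast
    ultimately show ?thesis using measure_nonneg[of lebesgue "A y - A x"] by linarith
  qed
  have "inj_on f N"
  proof (rule inj_onI, rule ccontr)
    fix x y assume xy: "x \<in> N" "y \<in> N" "f x = f y" "x \<noteq> y"
    show False
    proof (cases "lt x y")
      case True
      then show False using mono[OF xy(1,2)] xy(3) by simp
    next
      case False
      then have "lt y x" using total[OF xy(1,2,4)] by blast
      then show False using mono[OF xy(2,1)] xy(3) by simp
    qed
  qed
  moreover have "continuous_on N f"
    unfolding continuous_on_sequentially
  proof (intro allI ballI impI, elim conjE)
    fix x a assume a: "a \<in> N" and x: "\<forall>n. x n \<in> N" "x \<longlonglongrightarrow> a"
    have f_eq: "f y = (LINT t|lebesgue. indicator (A y) t)" if "y \<in> N" for y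
      using meas[OF that] by (simp add: f_def)
    have "AE t in lebesgue. t \<notin> {t. \<Gamma> t = a}"
      using fibre by (intro AE_not_in) (simp add: negligible_iff_null_sets)
    then have "AE t in lebesgue. (\<lambda>n. indicator (A (x n)) t) \<longlonglongrightarrow> (indicator (A a) t :: real)"
    proof (rule AE_mp, intro AE_I2 impI)
      fix t assume t: "t \<notin> {t. \<Gamma> t = a}"
      have "\<forall>\<^sub>F n in sequentially. t \<in> A (x n) \<longleftrightarrow> t \<in> A a"
      proof (cases "t \<in> {0..L} \<and> \<Gamma> t \<in> N")
        case True
        show ?thesis
        proof (cases "lt (\<Gamma> t) a")
          case lt: True
          then have "\<forall>\<^sub>F n in sequentially. x n \<in> {y \<in> N. lt (\<Gamma> t) y}"
            using eventually_in_openin[OF open_above] True a x by blast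
          then show ?thesis by eventually_elim (use True lt in \<open>simp add: A_def\<close>)
        next
          case gt: False
          then have "lt a (\<Gamma> t)" using total[of a "\<Gamma> t"] True a t by blast
          then have "\<forall>\<^sub>F n in sequentially. x n \<in> {y \<in> N. lt y (\<Gamma> t)}"
            using eventually_in_openin[OF open_below] True a x by blast
          then show ?thesis
          proof eventually_elim
            case (elim n)
            then have "\<not> lt (\<Gamma> t) (x n)" using asym[of "x n" "\<Gamma> t"] True by simp
            then show ?case using gt by (simp add: A_def)
          qed
        qed
      next
        case False
        then have "t \<notin> A y" for y by (auto simp: A_def)
        then show ?thesis by simp
      qed
      then have "\<forall>\<^sub>F n in sequentially. indicator (A (x n)) t = (indicator (A a) t :: real)"
        by eventually_elim (simp add: indicator_def)
      then show "(\<lambda>n. indicator (A (x n)) t) \<longlonglongrightarrow> (indicator (A a) t :: real)"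
        by (rule tendsto_eventually)
    qed
    then have "(\<lambda>n. LINT t|lebesgue. indicator (A (x n)) t) \<longlonglongrightarrow> (LINT t|lebesgue. (indicator (A a) t :: real))"
    proof (intro integral_dominated_convergence[where w = "indicator {0..L}"])
      show "(indicator (A a) :: real \<Rightarrow> real) \<in> borel_measurable lebesgue"
        using fmeasurableD[OF meas[OF a]] by (rule borel_measurable_indicator)
      show "(indicator (A (x n)) :: real \<Rightarrow> real) \<in> borel_measurable lebesgue" for n
        using fmeasurableD[OF meas] x(1) by (intro borel_measurable_indicator) blast
      show "integrable lebesgue (indicator {0..L} :: real \<Rightarrow> real)"
        using lmeasurable_cbox[of 0 L] by (simp add: lmeasurable_iff_integrable)
      show "AE t in lebesgue. norm (indicator (A (x n)) t :: real) \<le> indicator {0..L} t" for n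
        by (rule AE_I2) (auto simp: A_def indicator_def)
    qed
    moreover have "f \<circ> x = (\<lambda>n. LINT t|lebesgue. indicator (A (x n)) t)"
      using f_eq x(1) unfolding o_def by blast
    ultimately show "(f \<circ> x) \<longlonglongrightarrow> f a" using f_eq[OF a] by metis
  qed
  ultimately show thesis using that by blast
qed

section \<open>Charts\<close>

text \<open>
  If \<open>x\<close> is not the last point of the arc, then removing the last point from \<open>U\<close> and
  translating the first point to \<open>0\<close> gives a set that is open in the half-line, and not only in
  the compact interval. Here \<open>x\<close> may be the first point.
\<close>
lemma arc_chart:
  fixes f :: "'a::t2_space \<Rightarrow> real"
  assumes N: "compact N" "connected N" "N \<subseteq> M"
    and U: "openin (top_of_set M) U" "U \<subseteq> N" "x \<in> U"
    and f: "continuous_on N f" "inj_on f N"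
    and y: "y \<in> N" "f x < f y"
  shows "\<exists>U V. x \<in> U \<and> openin (top_of_set M) U \<and>
    openin (top_of_set {0::real..}) V \<and> U homeomorphic V"
proof -
  obtain a b where ab: "f ` N = {a..b}"
    using connected_continuous_image[OF f(1) N(2)] compact_continuous_image[OF f(1) N(1)]
    unfolding connected_compact_interval_1[symmetric] by (metis connected_compact_interval_1)
  define h where "h = (\<lambda>u. f u - a)"
  have h: "continuous_on N h" "inj_on h N" "h ` N = {0..b - a}"
  proof -
    show "continuous_on N h" unfolding h_def by (intro continuous_intros f)
    show "inj_on h N" using f(2) by (auto simp: h_def inj_on_def)
    have "h ` N = (\<lambda>u. u - a) ` {a..b}" unfolding ab[symmetric] by (auto simp: h_def)
    then show "h ` N = {0..b - a}" by simp
  qed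
  obtain g where g: "homeomorphism N {0..b - a} h g"
    using homeomorphism_compact[OF N(1) h(1,3,2)] by blast
  define U' where "U' = {u \<in> U. h u < b - a}"
  have "x \<in> U'"
    using U y ab by (auto simp: U'_def h_def) (metis atLeastAtMost_iff image_eqI order_less_le_trans)
  have opN: "openin (top_of_set N) U'"
  proof -
    have "openin (top_of_set N) (N \<inter> h -` {..<b - a})"
      using h(1) by (simp add: continuous_openin_preimage_gen)
    moreover have "openin (top_of_set N) U"
      using U N(3) by (meson openin_subset_trans)
    moreover have "U' = U \<inter> (N \<inter> h -` {..<b - a})" using U(2) by (auto simp: U'_def)
    ultimately show ?thesis by (metis openin_Int)
  qed
  have "openin (top_of_set U) U'"
    by (rule openin_subset_trans[OF opN _ U(2)]) (auto simp: U'_def)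
  then have opM: "openin (top_of_set M) U'" using U(1) openin_trans by blast
  have "openin (top_of_set {0..b - a}) (h ` U')"
    using homeomorphism_imp_open_map[OF g opN] .
  then obtain T where T: "open T" "h ` U' = {0..b - a} \<inter> T" unfolding openin_open by blast
  have "h ` U' = {0..} \<inter> (T \<inter> {..<b - a})"
    using T(2) by (fastforce simp: U'_def)
  then have "openin (top_of_set {0..}) (h ` U')"
    using T(1) by (metis open_Int open_lessThan openin_open_Int)
  moreover have "U' homeomorphic h ` U'"
  proof -
    have "homeomorphism U' (h ` U') h g"
      using g U(2) by (intro homeomorphism_of_subsets[OF g]) (auto simp: U'_def homeomorphism_def)
    then show ?thesis unfolding homeomorphic_def by blast
  qed
  ultimately show ?thesis using \<open>x \<in> U'\<close> opM by blast
qed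

text \<open>
  A nondegenerate arc has at least one end that is not \<open>x\<close>; reversing the arc if needed, this
  end is the last point.
\<close>
lemma arc_neighbourhood_chart:
  fixes f :: "'a::t2_space \<Rightarrow> real"
  assumes N: "compact N" "connected N" "N \<subseteq> M" "N \<noteq> {x}"
    and U: "openin (top_of_set M) U" "U \<subseteq> N" "x \<in> U"
    and f: "continuous_on N f" "inj_on f N"
  shows "\<exists>U V. x \<in> U \<and> openin (top_of_set M) U \<and>
    openin (top_of_set {0::real..}) V \<and> U homeomorphic V"
proof -
  obtain y where y: "y \<in> N" "y \<noteq> x" using N(4) U by blast
  then have "f y \<noteq> f x" using f(2) U by (meson inj_onD subsetD)
  then consider "f x < f y" | "- f x < - f y" by linarith
  then show ?thesis
  proof cases
    case 2
    have "inj_on (\<lambda>u. - f u) N" using f(2) by (auto simp: inj_on_def)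
    moreover have "continuous_on N (\<lambda>u. - f u)" using f(1) by (rule continuous_on_minus)
    ultimately show ?thesis using arc_chart[OF N(1-3) U _ _ y(1)] 2 by blast
  qed (rule arc_chart[OF N(1-3) U f y(1)])
qed

lemma locally_connected_compact_image:
  fixes f :: "'a::t2_space \<Rightarrow> 'b::t2_space"
  assumes "locally connected S" "compact S" "continuous_on S f"
  shows "locally connected (f ` S)"
  by (intro locally_connected_quotient_image closed_map_imp_quotient_map
      Abstract_Topology_2.continuous_imp_closed_map[OF _ assms(3) refl assms(2)] assms)

text \<open>
  One of \<open>a\<close> and \<open>b\<close> has distance at least \<open>dist a b / 2\<close> from \<open>x\<close>, so that the distance
  from \<open>x\<close> takes all smaller values on the connected set.
\<close>
lemma connected_meets_sphere:
  fixes \<gamma> :: "'a::metric_space set"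
  assumes "connected \<gamma>" "a \<in> \<gamma>" "b \<in> \<gamma>" "x \<in> \<gamma>" "0 \<le> r" "r \<le> dist a b / 2"
  shows "\<exists>z\<in>\<gamma>. dist x z = r"
proof -
  obtain c where c: "c \<in> \<gamma>" "r \<le> dist x c"
  proof (cases "r \<le> dist x a")
    case False
    then have "r \<le> dist x b" using dist_triangle3[of a b x] assms(6) by linarith
    then show ?thesis using that assms(3) by blast
  qed (use that assms(2) in blast)
  have "connected (dist x ` \<gamma>)" by (intro connected_continuous_image assms continuous_intros)
  moreover have "0 \<in> dist x ` \<gamma>" "dist x c \<in> dist x ` \<gamma>" using assms c by force+
  ultimately have "{0..dist x c} \<subseteq> dist x ` \<gamma>" by (rule connected_contains_Icc)
  then have "r \<in> dist x ` \<gamma>" using c assms(5) by auto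
  then show ?thesis by auto
qed

theorem theorem1p4:
  fixes L :: real and \<Gamma> :: "real \<Rightarrow> real ^ 'n" and \<gamma> :: "(real ^ 'n) set"
    and \<omega> :: "real \<Rightarrow> real"
  assumes "L > 0"
    and "arclength_closed_curve L \<Gamma>"
    and "\<gamma> = range \<Gamma>"
    and "continuous_on {0..L} \<omega>"
    and "mono_on {0..L} \<omega>"
    and "\<omega> 0 = 0"
    and "\<And>d. d \<in> {0<..L} \<Longrightarrow> (SUP x\<in>\<gamma>. jones_beta \<gamma> x d) \<le> \<omega> d"
  shows "one_dim_submanifold_with_boundary \<gamma>"
  unfolding one_dim_submanifold_with_boundary_def
proof
  fix x assume x: "x \<in> \<gamma>"
  note cont = arclength_closed_curve_continuous[OF assms(2)]
  have \<gamma>: "\<gamma> = \<Gamma> ` {0..L}" using assms arclength_closed_curve_range by blast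
  have conn: "connected \<gamma>" and comp: "compact \<gamma>"
    unfolding \<gamma> by (auto intro!: connected_continuous_image compact_continuous_image cont)
  have loc: "locally connected \<gamma>" unfolding \<gamma>
    by (intro locally_connected_compact_image cont convex_imp_locally_connected) auto
  obtain s where s: "\<Gamma> s \<noteq> \<Gamma> 0"
  proof -
    have "{t. \<Gamma> t = \<Gamma> 0} \<noteq> UNIV"
      using arclength_closed_curve_negligible_fibre[OF assms(2)] open_not_negligible[OF open_UNIV] by (metis UNIV_not_empty)
    then show thesis using that by auto
  qed
  obtain \<delta> where \<delta>: "\<delta> > 0" "\<And>d. d \<in> {0..L} \<Longrightarrow> d < \<delta> \<Longrightarrow> \<omega> d < 1/100"
  proof -
    have "0 \<in> {0..L}" "0 < (1/100::real)" using assms by auto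
    then obtain \<delta> where "\<delta> > 0" "\<And>d. d \<in> {0..L} \<Longrightarrow> dist d 0 < \<delta> \<Longrightarrow> dist (\<omega> d) (\<omega> 0) < 1/100"
      using assms(4) unfolding continuous_on_iff by metis
    then show thesis using that[of \<delta>] assms(6) by (fastforce simp: dist_real_def)
  qed
  \<comment> \<open>\<open>L\<close> and \<open>\<delta>\<close> keep the scale where \<open>\<beta> < 1/100\<close>; the distance of two points of \<open>\<gamma>\<close>
    guarantees that spheres of radius at most \<open>R\<close> meet \<open>\<gamma>\<close>.\<close>
  define R where "R = Min {L, \<delta> / 2, dist (\<Gamma> s) (\<Gamma> 0) / 2}"
  have R: "0 < R" "R \<le> L" "R < \<delta>" "R \<le> dist (\<Gamma> s) (\<Gamma> 0) / 2"
    using assms(1) \<delta>(1) s by (auto simp: R_def)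
  have sphere: "\<exists>z\<in>\<gamma>. dist p z = r" if "p \<in> \<gamma>" "0 < r" "r \<le> R" for p r
    using connected_meets_sphere[OF conn _ _ that(1), of "\<Gamma> s" "\<Gamma> 0" r] that R(4) assms(3) by auto
  have dir: "\<exists>u. norm u = 1 \<and>
       (\<forall>y\<in>\<gamma>. dist p y \<le> r \<longrightarrow> norm (y - p - ((y - p) \<bullet> u) *\<^sub>R u) \<le> 1/100 * r)"
    if "p \<in> \<gamma>" "0 < r" "r \<le> R" for p r
  proof -
    have "jones_beta \<gamma> p r \<le> (SUP x\<in>\<gamma>. jones_beta \<gamma> x r)"
      using that by (intro cSUP_upper bdd_aboveI2[of _ _ 1] jones_beta_le_1) auto
    also have "\<dots> \<le> \<omega> r" using that R by (intro assms(7)) auto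
    also have "\<dots> < 1/100" using that R by (intro \<delta>(2)) auto
    finally show ?thesis using jones_beta_less_imp_direction[OF that(1,2)] by metis
  qed
  obtain e :: "nat \<Rightarrow> real ^ 'n \<Rightarrow> real ^ 'n" where e:
    "\<And>k p. p \<in> \<gamma> \<inter> ball x (R/4) \<Longrightarrow> norm (e k p) = 1"
    "\<And>k p y. p \<in> \<gamma> \<inter> ball x (R/4) \<Longrightarrow> y \<in> \<gamma> \<inter> ball x (R/4) \<Longrightarrow> dist p y \<le> R / 2 / 2^k \<Longrightarrow>
       norm (y - p - ((y - p) \<bullet> e k p) *\<^sub>R e k p) \<le> 1/100 * (R / 2 / 2^k)"
    "\<And>k p. p \<in> \<gamma> \<inter> ball x (R/4) \<Longrightarrow> norm (e (Suc k) p - e k p) \<le> 1/10"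
    "\<And>k p y. p \<in> \<gamma> \<inter> ball x (R/4) \<Longrightarrow> y \<in> \<gamma> \<inter> ball x (R/4) \<Longrightarrow> dist p y \<le> R / 2 / 2^k \<Longrightarrow>
       norm (e k p - e k y) \<le> 1/5"
    using coherent_directions[OF R(1) x dir sphere] by blast
  let ?K = "\<gamma> \<inter> ball x (R/4)"
  have diam: "dist p y < R / 2" if "p \<in> ?K" "y \<in> ?K" for p y
    using that dist_triangle3[of p y x] by auto
  obtain lt where "separation_order ?K lt"
    using coherent_directions_imp_order[OF diam e] by blast
  \<comment> \<open>The closed ball makes the component \<open>N\<close> compact, and local connectedness of \<open>\<gamma>\<close> makes it a
    neighbourhood of \<open>x\<close>.\<close>
  define N where "N = connected_component_set (\<gamma> \<inter> cball x (R/8)) x"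
  have N_sub: "N \<subseteq> \<gamma> \<inter> cball x (R/8)" unfolding N_def by (rule connected_component_subset)
  have NK: "N \<subseteq> ?K" using N_sub R(1) by (auto simp: subset_iff)
  have "closed N" unfolding N_def
    using comp by (intro closed_connected_component closed_Int compact_imp_closed closed_cball)
  then have N: "compact N" "connected N" "N \<subseteq> \<gamma>"
    using N_sub compact_Int_closed[OF comp, of N] by (auto simp: N_def inf.absorb2)
  have "openin (top_of_set \<gamma>) (\<gamma> \<inter> ball x (R/8))" by blast
  then obtain U where U: "openin (top_of_set \<gamma>) U" "connected U" "x \<in> U" "U \<subseteq> \<gamma> \<inter> ball x (R/8)"
    using loc x R(1) unfolding locally_connected by (metis IntI centre_in_ball zero_less_divide_iff zero_less_numeral)
  have UN: "U \<subseteq> N" unfolding N_def using U by (intro connected_component_maximal) auto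
  have "N \<noteq> {x}"
  proof
    assume "N = {x}"
    then have "U = {x}" using UN U(3) by auto
    then have "openin (top_of_set \<gamma>) {x}" "closedin (top_of_set \<gamma>) {x}"
      using U(1) x by auto
    then have "\<gamma> = {x}" using conn unfolding connected_clopen by blast
    then show False using sphere[OF x R(1)] R(1) by auto
  qed
  have "connected_separation_order N lt"
    using separation_order.subset[OF \<open>separation_order ?K lt\<close> NK] N(2)
    by (simp add: connected_separation_order_def connected_separation_order_axioms_def)
  then obtain f :: "real ^ 'n \<Rightarrow> real" where "continuous_on N f" "inj_on f N"
    using separation_order_imp_real_embedding[OF assms(2,1)] N assms(3)
    by (metis compact_imp_closed)
  then show "\<exists>U V. x \<in> U \<and> openin (top_of_set \<gamma>) U \<and>
        openin (top_of_set {0::real..}) V \<and> U homeomorphic V"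
    using arc_neighbourhood_chart[OF N \<open>N \<noteq> {x}\<close> U(1) UN U(3)] by blast
qed

end
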